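(* Let $(X,\mathcal{A},\lambda)$ be a $\sigma$-finite measure space, $T:X\to X$ a null-preserving map, and $A\in\mathcal{A}$. Then the following are equivalent: (i) $A$ is a tail set; (ii) $A$ is the entrance to some corridor; (iii) $A\overset{.}{=}T^{-n}\hat{T}^nA$ for all $n\ge0$; (iv) $A$ and $A^c$ remain separated. In this case, a sequence $(A_n)_{n\ge0}$ in $\mathcal{A}$ is a corridor with entrance $A$ if and only if $$\hat{T}^nA\overset{.}{\subseteq}A_n\overset{.}{\subseteq}\hat{T}^nA\cup(\hat{T}^nX)^c\qquad\text{for } n\ge0 .$$ In particular, $(\hat{T}^nA)_{n\ge0}$ and $(\hat{T}^nA\cup(\hat{T}^nX)^c)_{n\ge0}$ are, respectively, the smallest and the largest (mod $\lambda$) corridor with entrance $A$.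
   Context: For $A,B\in\mathcal{A}$ write $A\overset{.}{\subseteq}B$ if $\lambda(A\setminus B)=0$ and $A\overset{.}{=}B$ if $\lambda(A\triangle B)=0$. A measurable map $T:X\to X$ is null-preserving if $\lambda(A)=0$ implies $\lambda(T^{-1}A)=0$ for $A\in\mathcal{A}$. An essential image of $A\in\mathcal{A}$ under $T$ is a set $A'\in\mathcal{A}$ such that $T^{-1}A'\overset{.}{\supseteq}A$ and such that every $B'\in\mathcal{A}$ with $T^{-1}B'\overset{.}{\supseteq}A$ satisfies $B'\overset{.}{\supseteq}A'$. In the present ($\sigma$-finite, null-preserving) setting every $A\in\mathcal{A}$ has essential images and they form exactly one equivalence class under $\overset{.}{=}$; $\hat{T}A$ denotes an arbitrary fixed essential image of $A$, and $\hat{T}^n$ is the $n$-fold iterate ($\hat{T}^0A=A$). A tail set is a set $A\in\mathcal{A}$ with $A\overset{.}{=}B$ for some $B\in\bigcap_{n\ge0}T^{-n}\mathcal{A}$. Sets $A,B\in\mathcal{A}$ remain separated if for every $n\ge0$ there is $A_n\in\mathcal{A}$ with $A\overset{.}{\subseteq}T^{-n}A_n$ and $B\overset{.}{\subseteq}T^{-n}A_n^c$. A sequence $(A_n)_{n\ge0}$ in $\mathcal{A}$ is a corridor with entrance $A$ if $A\overset{.}{=}T^{-n}A_n$ (equivalently $A^c\overset{.}{=}T^{-n}A_n^c$) for all $n\ge0$. *)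

theory Defs
  imports "HOL-Analysis.Analysis"
begin

text \<open>
  The phase space is \<^term>\<open>space M\<close>, so complements are \<^term>\<open>space M - A\<close> and the preimage under
  the \<open>n\<close>-th iterate is \<^term>\<open>(T ^^ n) -` A \<inter> space M\<close>.  Nullity is stated by membership in
  \<^term>\<open>null_sets M\<close> rather than by \<^term>\<open>emeasure M A = 0\<close>, because the latter also holds
  for every non-measurable \<^term>\<open>A\<close>.
\<close>

definition subset_mod :: "'a measure \<Rightarrow> 'a set \<Rightarrow> 'a set \<Rightarrow> bool" where
  "subset_mod M A B \<longleftrightarrow> A - B \<in> null_sets M"

definition eq_mod :: "'a measure \<Rightarrow> 'a set \<Rightarrow> 'a set \<Rightarrow> bool" where
  "eq_mod M A B \<longleftrightarrow> sym_diff A B \<in> null_sets M"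

definition preimg :: "'a measure \<Rightarrow> ('a \<Rightarrow> 'a) \<Rightarrow> nat \<Rightarrow> 'a set \<Rightarrow> 'a set" where
  "preimg M T n A = (T ^^ n) -` A \<inter> space M"

definition null_preserving :: "'a measure \<Rightarrow> ('a \<Rightarrow> 'a) \<Rightarrow> bool" where
  "null_preserving M T \<longleftrightarrow>
     T \<in> measurable M M \<and> (\<forall>A \<in> null_sets M. preimg M T 1 A \<in> null_sets M)"

definition essential_image :: "'a measure \<Rightarrow> ('a \<Rightarrow> 'a) \<Rightarrow> 'a set \<Rightarrow> 'a set \<Rightarrow> bool" where
  "essential_image M T A A' \<longleftrightarrow>
     A' \<in> sets M \<and> subset_mod M A (preimg M T 1 A') \<and>
     (\<forall>B' \<in> sets M. subset_mod M A (preimg M T 1 B') \<longrightarrow> subset_mod M A' B')"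

definition tail_set :: "'a measure \<Rightarrow> ('a \<Rightarrow> 'a) \<Rightarrow> 'a set \<Rightarrow> bool" where
  "tail_set M T A \<longleftrightarrow>
     A \<in> sets M \<and> (\<exists>B \<in> (\<Inter>n. preimg M T n ` sets M). eq_mod M A B)"

definition remain_separated :: "'a measure \<Rightarrow> ('a \<Rightarrow> 'a) \<Rightarrow> 'a set \<Rightarrow> 'a set \<Rightarrow> bool" where
  "remain_separated M T A B \<longleftrightarrow>
     (\<forall>n. \<exists>C \<in> sets M. subset_mod M A (preimg M T n C) \<and>
                        subset_mod M B (preimg M T n (space M - C)))"

definition corridor :: "'a measure \<Rightarrow> ('a \<Rightarrow> 'a) \<Rightarrow> 'a set \<Rightarrow> (nat \<Rightarrow> 'a set) \<Rightarrow> bool" where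
  "corridor M T A S \<longleftrightarrow>
     (\<forall>n. S n \<in> sets M) \<and> (\<forall>n. eq_mod M A (preimg M T n (S n)))"

definition smallest_corridor :: "'a measure \<Rightarrow> ('a \<Rightarrow> 'a) \<Rightarrow> 'a set \<Rightarrow> (nat \<Rightarrow> 'a set) \<Rightarrow> bool" where
  "smallest_corridor M T A S \<longleftrightarrow>
     corridor M T A S \<and> (\<forall>S'. corridor M T A S' \<longrightarrow> (\<forall>n. subset_mod M (S n) (S' n)))"

definition largest_corridor :: "'a measure \<Rightarrow> ('a \<Rightarrow> 'a) \<Rightarrow> 'a set \<Rightarrow> (nat \<Rightarrow> 'a set) \<Rightarrow> bool" where
  "largest_corridor M T A S \<longleftrightarrow>
     corridor M T A S \<and> (\<forall>S'. corridor M T A S' \<longrightarrow> (\<forall>n. subset_mod M (S' n) (S n)))"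

text \<open>
  Essential images exist, so a choice function \<open>That\<close> with
  \<open>\<forall>B \<in> sets M. essential_image M T B (That B)\<close> is always available.
\<close>

lemma essential_image_exists:
  assumes "sigma_finite_measure M" and np: "null_preserving M T" and A[measurable]: "A \<in> sets M"
  shows "\<exists>A'. essential_image M T A A'"
proof -
  interpret sigma_finite_measure M by fact
  have T[measurable]: "T \<in> measurable M M" using np by (simp add: null_preserving_def)
  define N where "N = distr (density M (indicator A)) M T"
  have N: "emeasure N C = emeasure M (A \<inter> (T -` C \<inter> space M))" if C[measurable]: "C \<in> sets M" for C
  proof -
    have "emeasure N C = emeasure (density M (indicator A)) (T -` C \<inter> space M)"
      by (simp add: N_def emeasure_distr)
    also have "\<dots> = (\<integral>\<^sup>+x. indicator A x * indicator (T -` C \<inter> space M) x \<partial>M)"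
      by (rule emeasure_density) auto
    also have "\<dots> = (\<integral>\<^sup>+x. indicator (A \<inter> (T -` C \<inter> space M)) x \<partial>M)"
      by (intro nn_integral_cong) (auto split: split_indicator)
    finally show ?thesis by simp
  qed
  have sN: "sets N = sets M" by (simp add: N_def)
  have "absolutely_continuous M N"
    unfolding absolutely_continuous_def
  proof
    fix C assume C: "C \<in> null_sets M"
    then have [measurable]: "C \<in> sets M" by auto
    have "T -` C \<inter> space M \<in> null_sets M"
      using np C by (simp add: null_preserving_def preimg_def)
    then have "A \<inter> (T -` C \<inter> space M) \<in> null_sets M"
      using A by (rule null_set_Int1)
    then show "C \<in> null_sets N" using N[of C] sN by (auto simp: null_sets_def)
  qed
  from Radon_Nikodym[OF this sN] obtain f where
    f[measurable]: "f \<in> borel_measurable M" and df: "density M f = N" by blast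
  define A' where "A' = {x \<in> space M. f x \<noteq> 0}"
  have A'[measurable]: "A' \<in> sets M" unfolding A'_def by measurable
  have key: "subset_mod M A (preimg M T 1 C) \<longleftrightarrow> subset_mod M A' C" if C[measurable]: "C \<in> sets M" for C
  proof -
    have sub: "A \<subseteq> space M" using A by (rule sets.sets_into_space)
    have "A - preimg M T 1 C = A \<inter> (T -` (space M - C) \<inter> space M)"
      using sub measurable_space[OF T] by (auto simp: preimg_def)
    then have "subset_mod M A (preimg M T 1 C) \<longleftrightarrow> emeasure N (space M - C) = 0"
      using N[of "space M - C"] by (simp add: subset_mod_def null_sets_def)
    also have "\<dots> \<longleftrightarrow> space M - C \<in> null_sets (density M f)"
      using df sN by (auto simp: null_sets_def)
    also have "\<dots> \<longleftrightarrow> (AE x in M. x \<in> space M - C \<longrightarrow> f x = 0)"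
      by (subst null_sets_density_iff) auto
    also have "\<dots> \<longleftrightarrow> (AE x in M. x \<notin> A' - C)"
      by (intro AE_cong) (auto simp: A'_def)
    also have "\<dots> \<longleftrightarrow> subset_mod M A' C"
      unfolding subset_mod_def by (subst AE_iff_null_sets) auto
    finally show ?thesis .
  qed
  have "essential_image M T A A'"
    unfolding essential_image_def using key A' by (auto simp: subset_mod_def)
  then show ?thesis by blast
qed

end

theory Submission
  imports Defs
begin

text \<open>
  The essential image is a lower adjoint modulo null sets: \<open>That\<^sup>n B \<subseteq> C\<close> if and only if
  \<open>B \<subseteq> T\<^sup>-\<^sup>n C\<close>.  Hence \<open>That\<^sup>n A\<close> is the smallest possible \<open>n\<close>-th member of a corridor with
  entrance \<open>A\<close>, and the upper bound follows by applying the adjunction to the whole space.  A corridor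
  \<open>S\<close> yields the exact tail representative \<open>limsup T\<^sup>-\<^sup>n S\<^sub>n\<close>: discarding the first \<open>k\<close> members does
  not change it, and all the others are preimages under \<open>T\<^sup>k\<close>.
\<close>

section \<open>Inclusion and equality modulo null sets\<close>

lemma subset_mod_iff_AE:
  assumes [measurable]: "A \<in> sets M" "B \<in> sets M"
  shows "subset_mod M A B \<longleftrightarrow> (AE x in M. x \<in> A \<longrightarrow> x \<in> B)"
proof -
  have "subset_mod M A B \<longleftrightarrow> (AE x in M. x \<notin> A - B)"
    unfolding subset_mod_def by (subst AE_iff_null_sets) auto
  also have "\<dots> \<longleftrightarrow> (AE x in M. x \<in> A \<longrightarrow> x \<in> B)"
    by (intro AE_cong) auto
  finally show ?thesis .
qed

lemma eq_mod_iff_AE: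
  assumes [measurable]: "A \<in> sets M" "B \<in> sets M"
  shows "eq_mod M A B \<longleftrightarrow> (AE x in M. x \<in> A \<longleftrightarrow> x \<in> B)"
proof -
  have "eq_mod M A B \<longleftrightarrow> (AE x in M. x \<notin> sym_diff A B)"
    unfolding eq_mod_def by (subst AE_iff_null_sets) auto
  also have "\<dots> \<longleftrightarrow> (AE x in M. x \<in> A \<longleftrightarrow> x \<in> B)"
    by (intro AE_cong) auto
  finally show ?thesis .
qed

lemma eq_mod_iff_subset_mod:
  assumes "A \<in> sets M" "B \<in> sets M"
  shows "eq_mod M A B \<longleftrightarrow> subset_mod M A B \<and> subset_mod M B A"
  using assms by (auto simp: subset_mod_iff_AE eq_mod_iff_AE)

lemma subset_mod_refl: "subset_mod M A A"
  by (simp add: subset_mod_def)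

lemma subset_mod_trans:
  assumes "A \<in> sets M" "B \<in> sets M" "C \<in> sets M" "subset_mod M A B" "subset_mod M B C"
  shows "subset_mod M A C"
  using assms by (auto simp: subset_mod_iff_AE)

section \<open>Preimages under the iterates of a null-preserving map\<close>

locale null_preserving_map =
  fixes M :: "'a measure" and T :: "'a \<Rightarrow> 'a"
  assumes np: "null_preserving M T"
begin

lemma measurable_T [measurable]: "T \<in> measurable M M"
  using np by (simp add: null_preserving_def)

lemma measurable_funpow_T [measurable]: "T ^^ n \<in> measurable M M"
  by (rule measurable_compose_n) measurable

lemma sets_preimg [measurable, simp]: "C \<in> sets M \<Longrightarrow> preimg M T n C \<in> sets M"
  unfolding preimg_def by measurable

lemma funpow_in_space: "x \<in> space M \<Longrightarrow> (T ^^ n) x \<in> space M"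
  by (rule measurable_space[OF measurable_funpow_T])

lemma preimg_add: "preimg M T (m + n) C = preimg M T n (preimg M T m C)"
  using funpow_in_space by (auto simp: preimg_def funpow_add)

lemma preimg_null_sets: "N \<in> null_sets M \<Longrightarrow> preimg M T n N \<in> null_sets M"
proof (induction n)
  case 0
  then show ?case
    by (auto simp: preimg_def dest!: null_setsD2 intro: null_set_Int2)
next
  case (Suc n)
  then have "preimg M T 1 (preimg M T n N) \<in> null_sets M"
    using np by (simp add: null_preserving_def)
  then show ?case
    using preimg_add[of n 1 N] by simp
qed

text \<open>Preimages commute with set differences, so monotonicity reduces to null preservation of
  the iterates.\<close>

lemma preimg_mono_mod:
  assumes "subset_mod M B C"
  shows "subset_mod M (preimg M T n B) (preimg M T n C)"
proof -
  have "preimg M T n B - preimg M T n C = preimg M T n (B - C)"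
    by (auto simp: preimg_def)
  then show ?thesis
    using assms preimg_null_sets by (simp add: subset_mod_def)
qed

section \<open>Tail sets, corridors and separation from the complement\<close>

lemma tail_set_imp_corridor:
  assumes "tail_set M T A"
  shows "\<exists>S. corridor M T A S"
proof -
  obtain B where B: "B \<in> (\<Inter>n. preimg M T n ` sets M)" "eq_mod M A B"
    using assms by (auto simp: tail_set_def)
  then have "\<forall>n. \<exists>C. C \<in> sets M \<and> B = preimg M T n C" by blast
  then obtain S where "\<forall>n. S n \<in> sets M \<and> B = preimg M T n (S n)" by metis
  then have "corridor M T A S" using B by (auto simp: corridor_def)
  then show ?thesis by blast
qed

lemma corridor_imp_tail_set:
  assumes A: "A \<in> sets M" and S: "corridor M T A S"
  shows "tail_set M T A"
proof -
  \<comment> \<open>This is the limsup: the threshold is \<open>m\<close>, and \<open>n\<close> runs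
    over the excess above it.\<close>
  define B where "B = (\<Inter>m. \<Union>n. preimg M T (m + n) (S (m + n)))"
  have Ssets: "S n \<in> sets M" for n using S by (simp add: corridor_def)
  have in_B: "x \<in> B \<longleftrightarrow> (\<forall>m. \<exists>n\<ge>m. x \<in> preimg M T n (S n))" for x
    unfolding B_def by (auto simp: le_iff_add)
  \<comment> \<open>With threshold \<open>k + m\<close> every index is at least \<open>k\<close>, so
    a factor \<open>preimg M T k\<close> splits off by \<open>preimg_add\<close> and commutes with
    the countable union and intersection.\<close>
  have tail: "B = preimg M T k (\<Inter>m. \<Union>n. preimg M T (m + n) (S (k + m + n)))" for k
  proof -
    have "preimg M T k (\<Inter>m. \<Union>n. preimg M T (m + n) (S (k + m + n)))
        = (\<Inter>m. \<Union>n. preimg M T k (preimg M T (m + n) (S (k + m + n))))"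
      unfolding preimg_def by auto
    also have "\<dots> = (\<Inter>m. \<Union>n. preimg M T (k + m + n) (S (k + m + n)))"
      by (simp add: preimg_add[symmetric] ac_simps)
    also have "\<dots> = B"
    proof (rule set_eqI)
      fix x
      \<comment> \<open>The thresholds \<open>k + m\<close> are cofinal among all
        thresholds.\<close>
      have "x \<in> B \<longleftrightarrow> (\<forall>m. \<exists>n\<ge>k + m. x \<in> preimg M T n (S n))"
        unfolding in_B by (meson le_add2 order_trans)
      then show "x \<in> (\<Inter>m. \<Union>n. preimg M T (k + m + n) (S (k + m + n))) \<longleftrightarrow> x \<in> B"
        unfolding le_iff_add by blast
    qed
    finally show ?thesis by simp
  qed
  have "B \<in> preimg M T k ` sets M" for k
    by (subst tail[of k], rule imageI) (use Ssets in measurable)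
  moreover have Bsets: "B \<in> sets M"
    unfolding B_def using Ssets by measurable
  \<comment> \<open>Countably many null sets are merged into one. Off it, a point lies in all the
    preimages or in none, according to whether it lies in \<open>A\<close>, so the limsup agrees
    with \<open>A\<close> there.\<close>
  moreover have "AE x in M. \<forall>n. x \<in> A \<longleftrightarrow> x \<in> preimg M T n (S n)"
    using S A by (auto simp: AE_all_countable corridor_def eq_mod_iff_AE)
  then have "AE x in M. x \<in> A \<longleftrightarrow> x \<in> B"
    by eventually_elim (auto simp: in_B)
  then have "eq_mod M A B"
    using A Bsets by (simp add: eq_mod_iff_AE)
  ultimately show ?thesis
    using A by (auto simp: tail_set_def)
qed

text \<open>Preimages commute with complements, so the second separation condition is the reverse
  inclusion of the first. The separating sets, chosen one for each \<open>n\<close>, are thus the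
  members of a corridor.\<close>

lemma remain_separated_Compl_iff_corridor:
  assumes [measurable]: "A \<in> sets M"
  shows "remain_separated M T A (space M - A) \<longleftrightarrow> (\<exists>S. corridor M T A S)"
proof -
  have eq: "subset_mod M A (preimg M T n C) \<and> subset_mod M (space M - A) (preimg M T n (space M - C))
      \<longleftrightarrow> eq_mod M A (preimg M T n C)" if [measurable]: "C \<in> sets M" for n C
  proof -
    have "space M - A - preimg M T n (space M - C) = preimg M T n C - A"
      using funpow_in_space by (auto simp: preimg_def)
    then show ?thesis
      by (simp add: eq_mod_iff_subset_mod) (simp add: subset_mod_def)
  qed
  show ?thesis
    unfolding remain_separated_def corridor_def by (simp add: eq cong: bex_cong) metis
qed

end

section \<open>Iterated essential images and the extremal corridors\<close>

locale essential_image_choice = null_preserving_map +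
  fixes That :: "'a set \<Rightarrow> 'a set"
  assumes ess: "\<And>B. B \<in> sets M \<Longrightarrow> essential_image M T B (That B)"
begin

lemma sets_funpow_That [measurable, simp]: "B \<in> sets M \<Longrightarrow> (That ^^ n) B \<in> sets M"
  by (induction n) (use ess in \<open>auto simp: essential_image_def\<close>)

text \<open>The covering clause of \<open>essential_image\<close> is the unit of the adjunction, and
  monotonicity of preimages gives one direction from it; the minimality clause is the other
  direction.\<close>

lemma That_subset_mod_iff:
  assumes B: "B \<in> sets M" and C: "C \<in> sets M"
  shows "subset_mod M (That B) C \<longleftrightarrow> subset_mod M B (preimg M T 1 C)"
proof
  have "That B \<in> sets M" "subset_mod M B (preimg M T 1 (That B))"
    using ess[OF B] by (auto simp: essential_image_def)
  then show "subset_mod M B (preimg M T 1 C)" if "subset_mod M (That B) C"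
    using subset_mod_trans[OF B _ _ _ preimg_mono_mod[OF that]] C by simp
  show "subset_mod M (That B) C" if "subset_mod M B (preimg M T 1 C)"
    using ess[OF B] C that by (auto simp: essential_image_def)
qed

text \<open>Adjunctions compose. Peeling off the outermost \<open>That\<close> replaces
  \<open>C\<close> by its preimage, hence the induction is over arbitrary \<open>C\<close>.\<close>

lemma funpow_That_subset_mod_iff:
  assumes "B \<in> sets M" "C \<in> sets M"
  shows "subset_mod M ((That ^^ n) B) C \<longleftrightarrow> subset_mod M B (preimg M T n C)"
  using assms(2)
proof (induction n arbitrary: C)
  case 0
  then have "preimg M T 0 C = C"
    using sets.sets_into_space by (auto simp: preimg_def)
  then show ?case by simp
next
  case (Suc n)
  have "subset_mod M ((That ^^ Suc n) B) C \<longleftrightarrow> subset_mod M ((That ^^ n) B) (preimg M T 1 C)"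
    using That_subset_mod_iff Suc.prems assms(1) by simp
  also have "\<dots> \<longleftrightarrow> subset_mod M B (preimg M T n (preimg M T 1 C))"
    using Suc by simp
  finally show ?case
    using preimg_add[of 1 n C] by simp
qed

lemma subset_mod_preimg_funpow_That:
  assumes "B \<in> sets M"
  shows "subset_mod M B (preimg M T n ((That ^^ n) B))"
  using funpow_That_subset_mod_iff[of B "(That ^^ n) B" n] assms by (simp add: subset_mod_refl)

text \<open>Comparing preimages tests \<open>B\<close> and \<open>C\<close> only on the essential
  range of \<open>T ^^ n\<close>. The inclusion says that almost every point is mapped into
  \<open>C\<close> or outside \<open>B\<close>, to which the adjunction for \<open>space M\<close>
  applies.\<close>

lemma preimg_subset_mod_preimg_iff:
  assumes [measurable]: "B \<in> sets M" "C \<in> sets M"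
  shows "subset_mod M (preimg M T n B) (preimg M T n C)
    \<longleftrightarrow> subset_mod M B (C \<union> (space M - (That ^^ n) (space M)))"
proof -
  have "preimg M T n B - preimg M T n C = space M - preimg M T n (C \<union> (space M - B))"
    using funpow_in_space by (auto simp: preimg_def)
  then have "subset_mod M (preimg M T n B) (preimg M T n C)
      \<longleftrightarrow> subset_mod M (space M) (preimg M T n (C \<union> (space M - B)))"
    by (simp add: subset_mod_def)
  also have "\<dots> \<longleftrightarrow> subset_mod M ((That ^^ n) (space M)) (C \<union> (space M - B))"
    by (simp add: funpow_That_subset_mod_iff)
  \<comment> \<open>Both sides are the part of \<open>B\<close> inside the essential range and
    outside \<open>C\<close>.\<close>
  also have "(That ^^ n) (space M) - (C \<union> (space M - B)) = B - (C \<union> (space M - (That ^^ n) (space M)))"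
    using sets.sets_into_space[of B M] sets.sets_into_space[of "(That ^^ n) (space M)" M] by auto
  then have "subset_mod M ((That ^^ n) (space M)) (C \<union> (space M - B))
      \<longleftrightarrow> subset_mod M B (C \<union> (space M - (That ^^ n) (space M)))"
    by (simp add: subset_mod_def)
  finally show ?thesis .
qed

text \<open>A squeeze: the unit puts \<open>A\<close> below the preimage of
  \<open>(That ^^ n) A\<close>, and the adjunction puts that preimage below the one of
  \<open>S n\<close>, which is \<open>A\<close> again modulo null sets.\<close>

lemma corridor_imp_eq_mod_preimg_That:
  assumes A: "A \<in> sets M" and S: "corridor M T A S"
  shows "eq_mod M A (preimg M T n ((That ^^ n) A))"
proof -
  have Sn: "S n \<in> sets M" "subset_mod M A (preimg M T n (S n))" "subset_mod M (preimg M T n (S n)) A"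
    using S A by (auto simp: corridor_def eq_mod_iff_subset_mod)
  then have "subset_mod M (preimg M T n ((That ^^ n) A)) (preimg M T n (S n))"
    using A by (intro preimg_mono_mod) (simp add: funpow_That_subset_mod_iff)
  then have "subset_mod M (preimg M T n ((That ^^ n) A)) A"
    using subset_mod_trans[OF _ _ A _ Sn(3)] Sn(1) A by simp
  then show ?thesis
    using A by (simp add: eq_mod_iff_subset_mod subset_mod_preimg_funpow_That)
qed

text \<open>The lower bound is the adjunction. For the upper bound, \<open>A\<close> is replaced by
  the preimage of \<open>(That ^^ n) A\<close>, so that two preimages are compared.\<close>

lemma corridor_iff_between:
  assumes A: "A \<in> sets M" and eq: "\<And>n. eq_mod M A (preimg M T n ((That ^^ n) A))"
    and S: "\<And>n. S n \<in> sets M"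
  shows "corridor M T A S \<longleftrightarrow>
    (\<forall>n. subset_mod M ((That ^^ n) A) (S n) \<and>
         subset_mod M (S n) ((That ^^ n) A \<union> (space M - (That ^^ n) (space M))))"
proof -
  have "eq_mod M A (preimg M T n (S n)) \<longleftrightarrow>
      subset_mod M ((That ^^ n) A) (S n) \<and>
      subset_mod M (S n) ((That ^^ n) A \<union> (space M - (That ^^ n) (space M)))" for n
  proof -
    let ?P = "preimg M T n (S n)" and ?Q = "preimg M T n ((That ^^ n) A)"
    have P: "?P \<in> sets M" and Q: "?Q \<in> sets M"
      using S A by auto
    have AQ: "subset_mod M A ?Q" "subset_mod M ?Q A"
      using eq[of n] A Q by (auto simp: eq_mod_iff_subset_mod)
    have "subset_mod M ?P A \<longleftrightarrow> subset_mod M ?P ?Q"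
      using subset_mod_trans[OF P A Q _ AQ(1)] subset_mod_trans[OF P Q A _ AQ(2)] by blast
    then show ?thesis
      unfolding eq_mod_iff_subset_mod[OF A P] funpow_That_subset_mod_iff[OF A S]
      using preimg_subset_mod_preimg_iff[OF S sets_funpow_That[OF A]] by blast
  qed
  then show ?thesis
    using S by (simp add: corridor_def)
qed

end

theorem theorem5p1:
  fixes M :: "'a measure" and T :: "'a \<Rightarrow> 'a" and That :: "'a set \<Rightarrow> 'a set" and A :: "'a set"
  assumes "sigma_finite_measure M"
    and "null_preserving M T"
    and "\<forall>B \<in> sets M. essential_image M T B (That B)"
    and "A \<in> sets M"
  shows "(tail_set M T A \<longleftrightarrow> (\<exists>S. corridor M T A S))
       \<and> ((\<exists>S. corridor M T A S) \<longleftrightarrow> (\<forall>n. eq_mod M A (preimg M T n ((That ^^ n) A))))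
       \<and> ((\<forall>n. eq_mod M A (preimg M T n ((That ^^ n) A))) \<longleftrightarrow> remain_separated M T A (space M - A))
       \<and> (tail_set M T A \<longrightarrow>
            (\<forall>S. (\<forall>n. S n \<in> sets M) \<longrightarrow>
               (corridor M T A S \<longleftrightarrow>
                  (\<forall>n. subset_mod M ((That ^^ n) A) (S n) \<and>
                       subset_mod M (S n) ((That ^^ n) A \<union> (space M - (That ^^ n) (space M))))))
          \<and> smallest_corridor M T A (\<lambda>n. (That ^^ n) A)
          \<and> largest_corridor M T A (\<lambda>n. (That ^^ n) A \<union> (space M - (That ^^ n) (space M))))"
proof -
  interpret essential_image_choice M T That
    using assms by unfold_locales auto
  note A = assms(4)
  have tail: "tail_set M T A \<longleftrightarrow> (\<exists>S. corridor M T A S)"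
    using tail_set_imp_corridor corridor_imp_tail_set[OF A] by blast
  \<comment> \<open>For the converse, the iterated essential images themselves form a
    corridor.\<close>
  have iter: "(\<exists>S. corridor M T A S) \<longleftrightarrow> (\<forall>n. eq_mod M A (preimg M T n ((That ^^ n) A)))"
    using corridor_imp_eq_mod_preimg_That[OF A] A
    by (auto simp: corridor_def intro!: exI[of _ "\<lambda>n. (That ^^ n) A"])
  have between: "corridor M T A S \<longleftrightarrow>
      (\<forall>n. subset_mod M ((That ^^ n) A) (S n) \<and>
           subset_mod M (S n) ((That ^^ n) A \<union> (space M - (That ^^ n) (space M))))"
    if "tail_set M T A" "\<forall>n. S n \<in> sets M" for S
    using corridor_iff_between[OF A] that tail iter by blast
  have Un: "subset_mod M B (B \<union> C)" for B C
    by (simp add: subset_mod_def Diff_Un)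
  have sets: "\<forall>n. S n \<in> sets M" if "corridor M T A S" for S
    using that by (simp add: corridor_def)
  \<comment> \<open>Each of the two bounds satisfies the criterion \<open>between\<close> and is
    therefore a corridor; applied to any other corridor, the criterion gives extremality.\<close>
  have small: "smallest_corridor M T A (\<lambda>n. (That ^^ n) A)" if t: "tail_set M T A"
    unfolding smallest_corridor_def
  proof (intro conjI allI impI)
    show "corridor M T A (\<lambda>n. (That ^^ n) A)"
      using A by (subst between[OF t]) (auto simp: subset_mod_refl Un)
  qed (use between[OF t] sets in blast)
  have large: "largest_corridor M T A (\<lambda>n. (That ^^ n) A \<union> (space M - (That ^^ n) (space M)))"
    if t: "tail_set M T A"
    unfolding largest_corridor_def
  proof (intro conjI allI impI)
    show "corridor M T A (\<lambda>n. (That ^^ n) A \<union> (space M - (That ^^ n) (space M)))"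
      using A by (subst between[OF t]) (auto simp: subset_mod_refl Un)
  qed (use between[OF t] sets in blast)
  show ?thesis
    using tail iter remain_separated_Compl_iff_corridor[OF A] between small large by blast
qed

end
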